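(* Let $\Phi$ be a c-map (as in the context) on $D=K^s$ and let $\bar\alpha\in D$. Suppose that $\alpha^{(n)}_{\phi(\bar\alpha^{(n)})}\neq0$ for infinitely many $n$, where $\bar\alpha^{(n)}=(\alpha^{(n)}_1,\dots,\alpha^{(n)}_s)^T$ is the $n$-th remainder. Then $\lim_{n\to\infty}\pi(\bar\alpha;n)=\bar\alpha$ in $\mathbb{Q}_p^s$ (the limit being taken over those $n$ for which $\pi(\bar\alpha;n)$ is defined).
   Context: Let $p$ be a prime; $\mathrm{ord}_p$ is the $p$-adic valuation ($\mathrm{ord}_p(0)=\infty$), $|x|_p=p^{-\mathrm{ord}_p(x)}$, $U_p=\mathbb{Z}_p\setminus p\mathbb{Z}_p$, and for $\bar x\in\mathbb{Q}_p^s$, $|\bar x|_p=\max_i|x_i|_p$. Let $K\subset\mathbb{Q}_p$ be a finite extension of $\mathbb{Q}$ of degree $d$, $s=d-1$ if $d\ge2$ and $s=1$ if $d=1$, $D=K^s$, $E=(p\mathbb{Z}_p)^s\cap K^s$. A c-map $\Phi$ assigns to each $\bar\alpha=(\alpha_1,\dots,\alpha_s)^T\in D$ a quadruple $(\phi(\bar\alpha),F_{\bar\alpha},A_{\bar\alpha},\gamma(\bar\alpha))$ with $\phi(\bar\alpha)\in\{1,\dots,s\}$, $A_{\bar\alpha}$ an invertible $s\times s$ matrix whose entries and whose inverse's entries lie in $\mathbb{Z}_p\cap\mathbb{Q}$, $\gamma(\bar\alpha)\in(p\mathbb{Z}_p\cap\mathbb{Q})^s$ with $\gamma(\bar0)=\bar0$,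 and $F_{\bar\alpha}=(f_1,\dots,f_s)^T$ given as follows, with $j=\phi(\bar\alpha)$. If $\alpha_j\ne0$, $F_{\bar\alpha}$ is defined on $\{\bar x\in D:x_j\ne0\}$ by $f_j(\bar x)=\frac{u_jp^{\mathrm{ord}_p(\alpha_j)}}{x_j}-v_j$ and $f_i(\bar x)=\frac{u'_ip^{k_i}x_i}{x_j}-v'_i$ for $i\ne j$, where $u_j,v_j,u'_i\in U_p\cap\mathbb{Q}$, $v'_i\in\mathbb{Z}_p\cap\mathbb{Q}$ (depending on $\bar\alpha$), $k_i=\max\{\mathrm{ord}_p(\alpha_j)-\mathrm{ord}_p(\alpha_i),0\}$, and these constants are such that $f_i(\bar\alpha)\in p\mathbb{Z}_p$ for all $i$. If $\alpha_j=0$, $F_{\bar\alpha}$ is the identity of $D$. Put $T_{\bar\alpha}(\bar x)=A_{\bar\alpha}F_{\bar\alpha}(\bar x)+\gamma(\bar\alpha)$; this is injective on its domain and $T_{\bar\alpha}^{-1}$ denotes its inverse. The remainders are $\bar\alpha^{(0)}=\bar\alpha$, $\bar\alpha^{(n+1)}=T_{\bar\alpha^{(n)}}(\bar\alpha^{(n)})$, and the $n$-th convergent is $\pi(\bar\alpha;n)=T_{\bar\alpha^{(0)}}^{-1}\circ\cdots\circ T_{\bar\alpha^{(n-1)}}^{-1}(\bar0)$ ($n>0$), whenever this composition is defined. *)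

theory Defs
  imports "HOL-Analysis.Analysis" "Berlekamp_Zassenhaus.Finite_Field"
begin

section \<open>The p-adic absolute value on the rationals\<close>

definition rat_ord :: "nat \<Rightarrow> rat \<Rightarrow> int" where
  "rat_ord p q = int (multiplicity (int p) (fst (quotient_of q)))
               - int (multiplicity (int p) (snd (quotient_of q)))"

definition rat_abs :: "nat \<Rightarrow> rat \<Rightarrow> real" where
  "rat_abs p q = (if q = 0 then 0 else real p powi (- rat_ord p q))"

definition rat_null :: "nat \<Rightarrow> (nat \<Rightarrow> rat) \<Rightarrow> bool" where
  "rat_null p X \<longleftrightarrow> (\<lambda>n. rat_abs p (X n)) \<longlonglongrightarrow> 0"

definition rat_cauchy :: "nat \<Rightarrow> (nat \<Rightarrow> rat) \<Rightarrow> bool" where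
  "rat_cauchy p X \<longleftrightarrow> (\<forall>e>0. \<exists>N. \<forall>m\<ge>N. \<forall>n\<ge>N. rat_abs p (X m - X n) < e)"

lemma rat_as_frac:
  fixes q :: rat
  obtains a b where "b \<noteq> 0" "q = of_int a / of_int b"
  by (metis quotient_of_denom_pos quotient_of_div less_irrefl surj_pair)

context
  fixes p :: nat
  assumes p: "prime p"
begin

lemma pint: "prime_elem (int p)" "\<not> is_unit (int p)"
  using p by (auto simp: prime_imp_prime_elem dest: not_prime_unit)

lemma rat_ord_Fract:
  assumes "a \<noteq> 0" "b \<noteq> 0"
  shows "rat_ord p (of_int a / of_int b) = int (multiplicity (int p) a) - int (multiplicity (int p) b)"
proof -
  define q :: rat where "q = of_int a / of_int b"
  obtain c d where cd: "quotient_of q = (c, d)" by fastforce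
  have d: "d > 0" using cd quotient_of_denom_pos by blast
  have q: "q = of_int c / of_int d" using cd by (rule quotient_of_div)
  have "of_int (a * d) = (of_int (c * b) :: rat)"
    using q d assms unfolding q_def by (simp add: field_simps)
  then have eq: "a * d = c * b" by (simp only: of_int_eq_iff)
  then have c: "c \<noteq> 0" using assms d by auto
  have "multiplicity (int p) a + multiplicity (int p) d
      = multiplicity (int p) c + multiplicity (int p) b"
    using eq assms c d pint by (metis prime_elem_multiplicity_mult_distrib less_irrefl)
  then show ?thesis unfolding rat_ord_def q_def[symmetric] cd by simp
qed

lemma rat_ord_mult: "x \<noteq> 0 \<Longrightarrow> y \<noteq> 0 \<Longrightarrow> rat_ord p (x * y) = rat_ord p x + rat_ord p y"
proof -
  assume xy: "x \<noteq> 0" "y \<noteq> 0"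
  obtain a b where ab: "b \<noteq> 0" "x = of_int a / of_int b" by (rule rat_as_frac)
  obtain c d where cd: "d \<noteq> 0" "y = of_int c / of_int d" by (rule rat_as_frac)
  have nz: "a \<noteq> 0" "c \<noteq> 0" using xy ab cd by auto
  have "x * y = of_int (a * c) / of_int (b * d)" using ab cd by simp
  then show ?thesis
    using nz ab cd pint
    by (simp del: of_int_mult add: rat_ord_Fract prime_elem_multiplicity_mult_distrib)
qed

lemma rat_ord_add:
  assumes "x \<noteq> 0" "y \<noteq> 0" "x + y \<noteq> 0"
  shows "rat_ord p (x + y) \<ge> min (rat_ord p x) (rat_ord p y)"
proof -
  obtain a b where ab: "b \<noteq> 0" "x = of_int a / of_int b" by (rule rat_as_frac)
  obtain c d where cd: "d \<noteq> 0" "y = of_int c / of_int d" by (rule rat_as_frac)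
  have nz: "a \<noteq> 0" "c \<noteq> 0" using assms ab cd by auto
  have x: "x = of_int (a * d) / of_int (b * d)" and y: "y = of_int (c * b) / of_int (b * d)"
    using ab cd by simp_all
  have xy: "x + y = of_int (a * d + c * b) / of_int (b * d)"
    using ab cd by (simp add: field_simps)
  have nz3: "a * d + c * b \<noteq> 0" using xy assms(3) by force
  let ?k = "min (multiplicity (int p) (a * d)) (multiplicity (int p) (c * b))"
  have "int p ^ ?k dvd a * d" "int p ^ ?k dvd c * b"
    by (meson min.cobounded1 min.cobounded2 multiplicity_dvd')+
  then have "int p ^ ?k dvd a * d + c * b" by simp
  then have "multiplicity (int p) (a * d + c * b) \<ge> ?k"
    using nz3 pint by (simp add: multiplicity_geI)
  moreover have "a * d \<noteq> 0" "c * b \<noteq> 0" "b * d \<noteq> 0" using nz ab cd by auto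
  ultimately have k: "int ?k - int (multiplicity (int p) (b * d)) \<le> rat_ord p (x + y)"
    and "b * d \<noteq> 0"
    using rat_ord_Fract[OF nz3, of "b * d"] unfolding xy by linarith+
  moreover have "rat_ord p x = int (multiplicity (int p) (a * d)) - int (multiplicity (int p) (b * d))"
    using rat_ord_Fract[of "a * d" "b * d"] nz ab(1) cd(1) by (simp only: x mult_eq_0_iff simp_thms)
  moreover have "rat_ord p y = int (multiplicity (int p) (c * b)) - int (multiplicity (int p) (b * d))"
    using rat_ord_Fract[of "c * b" "b * d"] nz ab(1) cd(1) by (simp only: y mult_eq_0_iff simp_thms)
  ultimately show ?thesis by linarith
qed

lemma rat_abs_0 [simp]: "rat_abs p 0 = 0"
  by (simp add: rat_abs_def)

lemma rat_abs_pos: "x \<noteq> 0 \<Longrightarrow> rat_abs p x > 0"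
  using p prime_gt_0_nat by (simp add: rat_abs_def)

lemma rat_abs_nonneg [simp]: "rat_abs p x \<ge> 0"
  using rat_abs_pos[of x] by (cases "x = 0") auto

lemma rat_abs_eq_0_iff [simp]: "rat_abs p x = 0 \<longleftrightarrow> x = 0"
  using rat_abs_pos[of x] by (cases "x = 0") auto

lemma rat_abs_mult: "rat_abs p (x * y) = rat_abs p x * rat_abs p y"
  using p prime_gt_0_nat[of p] by (auto simp: rat_abs_def rat_ord_mult power_int_add power_int_diff
      power_int_minus field_simps)

lemma rat_abs_1 [simp]: "rat_abs p 1 = 1"
  using rat_abs_mult[of 1 1] rat_abs_pos[of 1] by simp

lemma rat_abs_minus [simp]: "rat_abs p (- x) = rat_abs p x"
proof -
  have "rat_abs p (-1) * rat_abs p (-1) = 1" using rat_abs_mult[of "-1" "-1"] by simp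
  then have "(rat_abs p (-1))\<^sup>2 = 1" by (simp only: power2_eq_square)
  then have "rat_abs p (-1) = 1"
    using rat_abs_nonneg[of "-1"] unfolding power2_eq_1_iff by linarith
  then show ?thesis using rat_abs_mult[of "-1" x] by simp
qed

lemma rat_abs_diff_commute: "rat_abs p (x - y) = rat_abs p (y - x)"
  using rat_abs_minus[of "x - y"] by simp

lemma rat_abs_inverse: "rat_abs p (inverse x) = inverse (rat_abs p x)"
proof (cases "x = 0")
  case False
  then have "rat_abs p x * rat_abs p (inverse x) = 1" using rat_abs_mult[of x "inverse x"] by simp
  then show ?thesis by (simp add: inverse_unique)
qed simp

lemma rat_abs_add: "rat_abs p (x + y) \<le> max (rat_abs p x) (rat_abs p y)"
proof (cases "x = 0 \<or> y = 0 \<or> x + y = 0")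
  case False
  have p1: "real p \<ge> 1" using p prime_ge_1_nat by simp
  have "rat_ord p (x + y) \<ge> min (rat_ord p x) (rat_ord p y)"
    using False by (intro rat_ord_add) auto
  then have "- rat_ord p (x + y) \<le> - rat_ord p x \<or> - rat_ord p (x + y) \<le> - rat_ord p y" by auto
  then have "real p powi (- rat_ord p (x + y)) \<le> real p powi (- rat_ord p x) \<or>
        real p powi (- rat_ord p (x + y)) \<le> real p powi (- rat_ord p y)"
    using p1 power_int_increasing by blast
  then show ?thesis using False by (auto simp: rat_abs_def)
qed (auto simp: le_max_iff_disj)

lemma rat_abs_triangle: "rat_abs p (x + y) \<le> rat_abs p x + rat_abs p y"
  using rat_abs_add[of x y] rat_abs_nonneg[of x] rat_abs_nonneg[of y] by linarith

lemma rat_abs_diff_lip: "\<bar>rat_abs p x - rat_abs p y\<bar> \<le> rat_abs p (x - y)"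
  using rat_abs_triangle[of "x - y" y] rat_abs_triangle[of "y - x" x]
    rat_abs_diff_commute[of x y] by simp

lemma rat_null_add: "rat_null p X \<Longrightarrow> rat_null p Y \<Longrightarrow> rat_null p (\<lambda>n. X n + Y n)"
  unfolding rat_null_def
  by (rule tendsto_sandwich[OF _ _ tendsto_const, of _ _ _ "\<lambda>n. rat_abs p (X n) + rat_abs p (Y n)"])
     (auto simp: rat_abs_triangle intro: tendsto_add_zero)

lemma rat_null_minus: "rat_null p X \<Longrightarrow> rat_null p (\<lambda>n. - X n)"
  unfolding rat_null_def by simp

lemma rat_null_diff: "rat_null p X \<Longrightarrow> rat_null p Y \<Longrightarrow> rat_null p (\<lambda>n. X n - Y n)"
  using rat_null_add[of X "\<lambda>n. - Y n"] rat_null_minus[of Y] by simp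

lemma rat_null_sym: "rat_null p (\<lambda>n. X n - Y n) \<Longrightarrow> rat_null p (\<lambda>n. Y n - X n)"
  using rat_null_minus[of "\<lambda>n. X n - Y n"] by simp

lemma rat_null_const [simp]: "rat_null p (\<lambda>n. c) \<longleftrightarrow> c = 0"
  unfolding rat_null_def by (simp add: LIMSEQ_const_iff)

lemma rat_cauchy_abs: "rat_cauchy p X \<Longrightarrow> convergent (\<lambda>n. rat_abs p (X n))"
proof -
  assume X: "rat_cauchy p X"
  have "Cauchy (\<lambda>n. rat_abs p (X n))"
    unfolding Cauchy_def dist_real_def
  proof (intro allI impI)
    fix e :: real assume "e > 0"
    then obtain N where "\<forall>m\<ge>N. \<forall>n\<ge>N. rat_abs p (X m - X n) < e"
      using X unfolding rat_cauchy_def by blast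
    then show "\<exists>M. \<forall>m\<ge>M. \<forall>n\<ge>M. \<bar>rat_abs p (X m) - rat_abs p (X n)\<bar> < e"
      using order.strict_trans1[OF rat_abs_diff_lip] by blast
  qed
  then show ?thesis by (rule Cauchy_convergent)
qed

lemma rat_cauchy_bounded: "rat_cauchy p X \<Longrightarrow> \<exists>b>0. \<forall>n. rat_abs p (X n) < b"
proof -
  assume "rat_cauchy p X"
  then have "Bseq (\<lambda>n. rat_abs p (X n))" by (intro convergent_imp_Bseq rat_cauchy_abs)
  then obtain K where "K > 0" "\<And>n. rat_abs p (X n) \<le> K" unfolding Bseq_def by auto
  then show ?thesis by (intro exI[of _ "K + 1"]) (simp add: add_pos_pos order.strict_trans1[of _ K])
qed

lemma rat_null_mult:
  assumes "\<exists>b>0. \<forall>n. rat_abs p (X n) < b" "rat_null p Y"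
  shows "rat_null p (\<lambda>n. X n * Y n)"
proof -
  obtain b where b: "b > 0" "\<And>n. rat_abs p (X n) < b" using assms by blast
  have "(\<lambda>n. b * rat_abs p (Y n)) \<longlonglongrightarrow> 0"
    using assms(2) unfolding rat_null_def by (rule tendsto_mult_right_zero)
  then show ?thesis unfolding rat_null_def rat_abs_mult
    by (rule tendsto_sandwich[OF _ _ tendsto_const, rotated 2])
       (auto intro!: always_eventually mult_right_mono less_imp_le[OF b(2)])
qed

lemma rat_cauchy_const [simp]: "rat_cauchy p (\<lambda>n. c)"
  by (auto simp: rat_cauchy_def)

lemma rat_cauchy_add:
  assumes "rat_cauchy p X" "rat_cauchy p Y" shows "rat_cauchy p (\<lambda>n. X n + Y n)"
  unfolding rat_cauchy_def
proof (intro allI impI)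
  fix e :: real assume e: "e > 0"
  obtain M where M: "\<forall>m\<ge>M. \<forall>n\<ge>M. rat_abs p (X m - X n) < e"
    using assms(1) e unfolding rat_cauchy_def by blast
  obtain N where N: "\<forall>m\<ge>N. \<forall>n\<ge>N. rat_abs p (Y m - Y n) < e"
    using assms(2) e unfolding rat_cauchy_def by blast
  have "rat_abs p (X m + Y m - (X n + Y n)) < e" if "m \<ge> max M N" "n \<ge> max M N" for m n
    using rat_abs_add[of "X m - X n" "Y m - Y n"] M N that by (force simp: algebra_simps)
  then show "\<exists>N. \<forall>m\<ge>N. \<forall>n\<ge>N. rat_abs p (X m + Y m - (X n + Y n)) < e" by blast
qed

lemma rat_cauchy_mult:
  assumes "rat_cauchy p X" "rat_cauchy p Y" shows "rat_cauchy p (\<lambda>n. X n * Y n)"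
  unfolding rat_cauchy_def
proof (intro allI impI)
  fix e :: real assume e: "e > 0"
  obtain a where a: "a > 0" "\<And>n. rat_abs p (X n) < a" using rat_cauchy_bounded[OF assms(1)] by blast
  obtain b where b: "b > 0" "\<And>n. rat_abs p (Y n) < b" using rat_cauchy_bounded[OF assms(2)] by blast
  obtain M where M: "\<forall>m\<ge>M. \<forall>n\<ge>M. rat_abs p (X m - X n) < e / b"
    using assms(1) e b(1) unfolding rat_cauchy_def by (meson divide_pos_pos)
  obtain N where N: "\<forall>m\<ge>N. \<forall>n\<ge>N. rat_abs p (Y m - Y n) < e / a"
    using assms(2) e a(1) unfolding rat_cauchy_def by (meson divide_pos_pos)
  have "rat_abs p (X m * Y m - X n * Y n) < e" if "m \<ge> max M N" "n \<ge> max M N" for m n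
  proof -
    have "rat_abs p (X m * (Y m - Y n)) < a * (e / a)" unfolding rat_abs_mult
      using a N that by (intro mult_strict_mono) auto
    moreover have "rat_abs p ((X m - X n) * Y n) < (e / b) * b" unfolding rat_abs_mult
      using b M that e by (intro mult_strict_mono) auto
    moreover have "X m * Y m - X n * Y n = X m * (Y m - Y n) + (X m - X n) * Y n"
      by (simp add: algebra_simps)
    ultimately show ?thesis using rat_abs_add[of "X m * (Y m - Y n)" "(X m - X n) * Y n"] a b
      by simp
  qed
  then show "\<exists>N. \<forall>m\<ge>N. \<forall>n\<ge>N. rat_abs p (X m * Y m - X n * Y n) < e" by blast
qed

lemma rat_cauchy_minus: "rat_cauchy p X \<Longrightarrow> rat_cauchy p (\<lambda>n. - X n)"
  using rat_cauchy_mult[of "\<lambda>_. -1" X] by simp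

lemma rat_cauchy_not_null:
  assumes "rat_cauchy p X" "\<not> rat_null p X"
  shows "\<exists>c>0. \<exists>N. \<forall>n\<ge>N. rat_abs p (X n) = c"
proof -
  obtain L where L: "(\<lambda>n. rat_abs p (X n)) \<longlonglongrightarrow> L"
    using rat_cauchy_abs[OF assms(1)] unfolding convergent_def by blast
  have "L \<noteq> 0" using L assms(2) unfolding rat_null_def by blast
  moreover have "L \<ge> 0" by (rule LIMSEQ_le_const[OF L]) simp
  ultimately have L0: "L > 0" by simp
  have "\<forall>\<^sub>F n in sequentially. rat_abs p (X n) > L / 2" using L0 by (intro order_tendstoD(1)[OF L]) simp
  then obtain M where M: "\<And>n. n \<ge> M \<Longrightarrow> rat_abs p (X n) > L / 2"
    unfolding eventually_sequentially by blast
  obtain N where N: "\<forall>m\<ge>N. \<forall>n\<ge>N. rat_abs p (X m - X n) < L / 2"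
    using assms(1) L0 unfolding rat_cauchy_def by (meson half_gt_zero)
  have "rat_abs p (X n) = rat_abs p (X (max M N))" if "n \<ge> max M N" for n
  proof (rule antisym)
    have d: "rat_abs p (X n - X (max M N)) < L / 2" "rat_abs p (X (max M N) - X n) < L / 2"
      using N that by auto
    have g: "rat_abs p (X n) > L / 2" "rat_abs p (X (max M N)) > L / 2" using M that by auto
    show "rat_abs p (X n) \<le> rat_abs p (X (max M N))"
      using rat_abs_add[of "X n - X (max M N)" "X (max M N)"] d g by simp
    show "rat_abs p (X (max M N)) \<le> rat_abs p (X n)"
      using rat_abs_add[of "X (max M N) - X n" "X n"] d g by simp
  qed
  moreover have "rat_abs p (X (max M N)) > 0" using M[of "max M N"] L0 by simp
  ultimately show ?thesis by blast
qed

lemma rat_cauchy_inverse: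
  assumes "rat_cauchy p X" "\<not> rat_null p X"
  shows "rat_cauchy p (\<lambda>n. inverse (X n))"
  unfolding rat_cauchy_def
proof (intro allI impI)
  fix e :: real assume e: "e > 0"
  obtain c M where c: "c > 0" "\<And>n. n \<ge> M \<Longrightarrow> rat_abs p (X n) = c"
    using rat_cauchy_not_null[OF assms] by blast
  have "e * c * c > 0" using e c by simp
  then obtain N where N: "\<forall>m\<ge>N. \<forall>n\<ge>N. rat_abs p (X m - X n) < e * c * c"
    using assms(1) unfolding rat_cauchy_def by blast
  have "rat_abs p (inverse (X m) - inverse (X n)) < e" if mn: "m \<ge> max M N" "n \<ge> max M N" for m n
  proof -
    have "X m \<noteq> 0" "X n \<noteq> 0" using c(1) c(2)[of m] c(2)[of n] mn by auto
    then have "inverse (X m) - inverse (X n) = inverse (X m) * inverse (X n) * (X n - X m)"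
      by (simp add: field_simps)
    then have "rat_abs p (inverse (X m) - inverse (X n)) = inverse c * inverse c * rat_abs p (X n - X m)"
      using mn c(2) by (simp add: rat_abs_mult rat_abs_inverse)
    also have "\<dots> < inverse c * inverse c * (e * c * c)"
      using c(1) N mn by (intro mult_strict_left_mono) auto
    also have "\<dots> = e" using c(1) by (simp add: field_simps)
    finally show ?thesis .
  qed
  then show "\<exists>N. \<forall>m\<ge>N. \<forall>n\<ge>N. rat_abs p (inverse (X m) - inverse (X n)) < e" by blast
qed

lemma rat_null_inverse_mult:
  assumes "rat_cauchy p X" "\<not> rat_null p X"
  shows "rat_null p (\<lambda>n. inverse (X n) * X n - 1)"
proof -
  obtain c M where c: "c > 0" "\<And>n. n \<ge> M \<Longrightarrow> rat_abs p (X n) = c"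
    using rat_cauchy_not_null[OF assms] by blast
  have "\<forall>n\<ge>M. rat_abs p (inverse (X n) * X n - 1) = 0"
  proof (intro allI impI)
    fix n assume "n \<ge> M"
    then have "X n \<noteq> 0" using c(1) c(2)[of n] by auto
    then show "rat_abs p (inverse (X n) * X n - 1) = 0" by simp
  qed
  then show ?thesis unfolding rat_null_def
    by (intro tendsto_eventually) (auto simp: eventually_sequentially)
qed

end


section \<open>The field of p-adic numbers\<close>

definition padicrel :: "'p::prime_card itself \<Rightarrow> ((nat \<Rightarrow> rat) \<times> (nat \<Rightarrow> rat)) set" where
  "padicrel _ = {(X, Y). rat_cauchy CARD('p) X \<and> rat_cauchy CARD('p) Y \<and>
                         rat_null CARD('p) (\<lambda>n. X n - Y n)}"

lemma equiv_padicrel: "equiv {X. rat_cauchy CARD('p::prime_card) X} (padicrel TYPE('p))"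
proof (rule equivI)
  show "padicrel TYPE('p) \<subseteq> {X. rat_cauchy CARD('p) X} \<times> {X. rat_cauchy CARD('p) X}"
    by (auto simp: padicrel_def)
  show "refl_on {X. rat_cauchy CARD('p) X} (padicrel TYPE('p))"
    by (auto intro!: refl_onI simp: padicrel_def rat_null_const[OF prime_card])
  show "sym (padicrel TYPE('p))"
    by (auto intro!: symI simp: padicrel_def rat_null_sym[OF prime_card])
  show "trans (padicrel TYPE('p))"
  proof (rule transI)
    fix X Y Z assume "(X, Y) \<in> padicrel TYPE('p)" "(Y, Z) \<in> padicrel TYPE('p)"
    then show "(X, Z) \<in> padicrel TYPE('p)"
      using rat_null_add[OF prime_card[where ?'a='p], of "\<lambda>n. X n - Y n" "\<lambda>n. Y n - Z n"]
      by (simp add: padicrel_def)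
  qed
qed

text \<open>Equivalence classes of p-adic Cauchy sequences of rationals modulo null sequences, where
  the prime p is the cardinality of the type parameter.\<close>

typedef (overloaded) ('p::prime_card) padic =
  "{X. rat_cauchy CARD('p) X} // padicrel TYPE('p)"
  by (rule exI[of _ "padicrel TYPE('p) `` {\<lambda>_. 0}"])
     (simp add: quotientI rat_cauchy_const[OF prime_card])

definition Padic :: "(nat \<Rightarrow> rat) \<Rightarrow> 'p::prime_card padic" where
  "Padic X = Abs_padic (padicrel TYPE('p) `` {X})"

definition rep_padic :: "'p::prime_card padic \<Rightarrow> nat \<Rightarrow> rat" where
  "rep_padic x = (SOME X. X \<in> Rep_padic x)"

lemma Padic_eq_iff:
  assumes "rat_cauchy CARD('p::prime_card) X" "rat_cauchy CARD('p) Y"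
  shows "(Padic X :: 'p padic) = Padic Y \<longleftrightarrow> rat_null CARD('p) (\<lambda>n. X n - Y n)"
proof -
  have "(Padic X :: 'p padic) = Padic Y \<longleftrightarrow> padicrel TYPE('p) `` {X} = padicrel TYPE('p) `` {Y}"
    unfolding Padic_def using assms by (simp add: Abs_padic_inject quotientI)
  also have "\<dots> \<longleftrightarrow> (X, Y) \<in> padicrel TYPE('p)"
    using assms by (simp add: eq_equiv_class_iff[OF equiv_padicrel])
  finally show ?thesis using assms by (simp add: padicrel_def)
qed

lemma Padic_rep: "rat_cauchy CARD('p::prime_card) (rep_padic x)" "Padic (rep_padic x) = (x :: 'p padic)"
proof -
  obtain X where X: "rat_cauchy CARD('p) X" "Rep_padic x = padicrel TYPE('p) `` {X}"
    using Rep_padic[of x] by (auto elim: quotientE)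
  have "(X, X) \<in> padicrel TYPE('p)"
    using X(1) by (simp add: padicrel_def rat_null_const[OF prime_card])
  then have "rep_padic x \<in> Rep_padic x"
    unfolding rep_padic_def X(2) by (intro someI[of "\<lambda>Y. Y \<in> padicrel TYPE('p) `` {X}" X]) simp
  then have r: "(X, rep_padic x) \<in> padicrel TYPE('p)" using X(2) by simp
  then show "rat_cauchy CARD('p) (rep_padic x)" by (simp add: padicrel_def)
  have "Padic (rep_padic x) = (Padic X :: 'p padic)"
    unfolding Padic_def using equiv_class_eq[OF equiv_padicrel r] by simp
  also have "\<dots> = x" unfolding Padic_def X(2)[symmetric] by (rule Rep_padic_inverse)
  finally show "Padic (rep_padic x) = x" .
qed

lemma padic_induct [case_names Padic, induct type: padic]:
  assumes "\<And>X. rat_cauchy CARD('p::prime_card) X \<Longrightarrow> P (Padic X :: 'p padic)"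
  shows "P x"
  using assms[OF Padic_rep(1)[of x]] by (simp add: Padic_rep(2))

lemma rep_Padic:
  assumes "rat_cauchy CARD('p::prime_card) X"
  shows "rat_null CARD('p) (\<lambda>n. rep_padic (Padic X :: 'p padic) n - X n)"
  using Padic_eq_iff[OF Padic_rep(1)[of "Padic X :: 'p padic"] assms]
  by (simp add: Padic_rep(2))

lemmas cauchy_simps = rat_null_const[OF prime_card] rat_cauchy_const[OF prime_card]
  rat_cauchy_add[OF prime_card] rat_cauchy_minus[OF prime_card] rat_cauchy_mult[OF prime_card]
  rat_cauchy_inverse[OF prime_card]

instantiation padic :: (prime_card) field
begin

definition "0 = (Padic (\<lambda>_. 0) :: 'a padic)"
definition "1 = (Padic (\<lambda>_. 1) :: 'a padic)"
definition "x + y = (Padic (\<lambda>n. rep_padic x n + rep_padic y n) :: 'a padic)"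
definition "- x = (Padic (\<lambda>n. - rep_padic x n) :: 'a padic)"
definition "x * y = (Padic (\<lambda>n. rep_padic x n * rep_padic y n) :: 'a padic)"
definition "inverse x = (if x = 0 then 0 else Padic (\<lambda>n. inverse (rep_padic x n)) :: 'a padic)"
definition "x - y = x + - (y :: 'a padic)"
definition "x div y = x * inverse (y :: 'a padic)"

lemma Padic_eq_0_iff:
  "rat_cauchy CARD('a) X \<Longrightarrow> (Padic X :: 'a padic) = 0 \<longleftrightarrow> rat_null CARD('a) X"
  unfolding zero_padic_def by (simp add: Padic_eq_iff cauchy_simps)

lemma plus_Padic:
  assumes X: "rat_cauchy CARD('a) X" and Y: "rat_cauchy CARD('a) Y"
  shows "(Padic X + Padic Y :: 'a padic) = Padic (\<lambda>n. X n + Y n)"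
proof -
  let ?X = "rep_padic (Padic X :: 'a padic)" and ?Y = "rep_padic (Padic Y :: 'a padic)"
  have "rat_null CARD('a) (\<lambda>n. (?X n - X n) + (?Y n - Y n))"
    by (rule rat_null_add[OF prime_card rep_Padic[OF X] rep_Padic[OF Y]])
  also have "(\<lambda>n. (?X n - X n) + (?Y n - Y n)) = (\<lambda>n. (?X n + ?Y n) - (X n + Y n))"
    by (simp add: algebra_simps)
  finally show ?thesis
    unfolding plus_padic_def by (simp add: Padic_eq_iff cauchy_simps Padic_rep X Y)
qed

lemma uminus_Padic:
  assumes X: "rat_cauchy CARD('a) X"
  shows "(- Padic X :: 'a padic) = Padic (\<lambda>n. - X n)"
proof -
  have "rat_null CARD('a) (\<lambda>n. X n - rep_padic (Padic X :: 'a padic) n)"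
    by (rule rat_null_sym[OF prime_card rep_Padic[OF X]])
  then show ?thesis
    unfolding uminus_padic_def by (simp add: Padic_eq_iff cauchy_simps Padic_rep X)
qed

lemma times_Padic:
  assumes X: "rat_cauchy CARD('a) X" and Y: "rat_cauchy CARD('a) Y"
  shows "(Padic X * Padic Y :: 'a padic) = Padic (\<lambda>n. X n * Y n)"
proof -
  let ?X = "rep_padic (Padic X :: 'a padic)" and ?Y = "rep_padic (Padic Y :: 'a padic)"
  have "rat_null CARD('a) (\<lambda>n. ?X n * (?Y n - Y n) + Y n * (?X n - X n))"
    by (rule rat_null_add[OF prime_card
          rat_null_mult[OF prime_card rat_cauchy_bounded[OF prime_card Padic_rep(1)] rep_Padic[OF Y]]
          rat_null_mult[OF prime_card rat_cauchy_bounded[OF prime_card Y] rep_Padic[OF X]]])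
  also have "(\<lambda>n. ?X n * (?Y n - Y n) + Y n * (?X n - X n)) = (\<lambda>n. ?X n * ?Y n - X n * Y n)"
    by (simp add: algebra_simps)
  finally show ?thesis
    unfolding times_padic_def by (simp add: Padic_eq_iff cauchy_simps Padic_rep X Y)
qed

instance
proof
  fix a b c :: "'a padic"
  show "a + b = b + a"
    by (simp add: plus_padic_def add.commute)
  show "(a + b) + c = a + (b + c)"
    by (induction a; induction b; induction c) (simp add: plus_Padic cauchy_simps add.assoc)
  show "0 + a = a"
    by (induction a) (simp add: zero_padic_def plus_Padic cauchy_simps)
  show "- a + a = 0"
    by (induction a) (simp add: zero_padic_def uminus_Padic plus_Padic cauchy_simps)
  show "a - b = a + - b" by (rule minus_padic_def)
  show "(a * b) * c = a * (b * c)"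
    by (induction a; induction b; induction c) (simp add: times_Padic cauchy_simps mult.assoc)
  show "a * b = b * a"
    by (simp add: times_padic_def mult.commute)
  show "1 * a = a"
    by (induction a) (simp add: one_padic_def times_Padic cauchy_simps)
  show "(a + b) * c = a * c + b * c"
    by (induction a; induction b; induction c)
       (simp add: times_Padic plus_Padic cauchy_simps algebra_simps)
  show "(0::'a padic) \<noteq> 1"
    by (simp add: zero_padic_def one_padic_def Padic_eq_iff cauchy_simps)
  show "inverse (0::'a padic) = 0" by (simp add: inverse_padic_def)
  show "a div b = a * inverse b" by (rule divide_padic_def)
  show "inverse a * a = 1" if "a \<noteq> 0"
  proof -
    let ?X = "rep_padic a"
    have X: "rat_cauchy CARD('a) ?X" "\<not> rat_null CARD('a) ?X"
      using that Padic_eq_0_iff[OF Padic_rep(1)[of a]] by (auto simp: Padic_rep)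
    have "inverse a * a = Padic (\<lambda>n. inverse (?X n)) * Padic ?X"
      using that by (simp add: inverse_padic_def Padic_rep)
    also have "\<dots> = 1"
      using X by (simp add: times_Padic one_padic_def Padic_eq_iff cauchy_simps
          rat_null_inverse_mult[OF prime_card])
    finally show ?thesis .
  qed
qed

end

lemma of_nat_padic: "(of_nat n :: 'p::prime_card padic) = Padic (\<lambda>_. of_nat n)"
  by (induction n) (simp_all add: zero_padic_def one_padic_def plus_Padic cauchy_simps)

instance padic :: (prime_card) field_char_0
  by standard (auto intro!: injI simp: of_nat_padic Padic_eq_iff cauchy_simps)

definition padic_abs :: "'p::prime_card padic \<Rightarrow> real" where
  "padic_abs x = lim (\<lambda>n. rat_abs CARD('p) (rep_padic x n))"

lemma padic_abs_Padic:
  assumes X: "rat_cauchy CARD('p::prime_card) X"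
  shows "(\<lambda>n. rat_abs CARD('p) (X n)) \<longlonglongrightarrow> padic_abs (Padic X :: 'p padic)"
proof -
  let ?X = "rep_padic (Padic X :: 'p padic)"
  obtain a where a: "(\<lambda>n. rat_abs CARD('p) (X n)) \<longlonglongrightarrow> a"
    using rat_cauchy_abs[OF prime_card X] unfolding convergent_def by blast
  have "(\<lambda>n. rat_abs CARD('p) (?X n) - rat_abs CARD('p) (X n)) \<longlonglongrightarrow> 0"
    using rep_Padic[OF X] unfolding rat_null_def
    by (rule tendsto_0_le[where K = 1])
       (simp add: rat_abs_diff_lip[OF prime_card] rat_abs_nonneg[OF prime_card])
  from tendsto_add[OF this a] have "(\<lambda>n. rat_abs CARD('p) (?X n)) \<longlonglongrightarrow> a" by simp
  then show ?thesis using a by (simp add: padic_abs_def limI)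
qed

lemma of_int_padic: "(of_int k :: 'p::prime_card padic) = Padic (\<lambda>_. of_int k)"
  by (cases k rule: int_diff_cases)
     (simp add: of_nat_padic minus_padic_def uminus_Padic plus_Padic cauchy_simps)

lemma of_rat_padic: "(of_rat q :: 'p::prime_card padic) = Padic (\<lambda>_. q)"
proof -
  obtain a b where ab: "b \<noteq> 0" "q = of_int a / of_int b" by (rule rat_as_frac)
  have "of_rat q * (of_int b :: 'p padic) = of_int a" using ab by (simp add: of_rat_divide)
  also have "\<dots> = Padic (\<lambda>_. q) * of_int b"
    using ab by (simp add: of_int_padic times_Padic cauchy_simps)
  finally show ?thesis using ab by simp
qed

lemma padic_abs_of_rat: "padic_abs (of_rat q :: 'p::prime_card padic) = rat_abs CARD('p) q"
  using padic_abs_Padic[OF rat_cauchy_const[OF prime_card], where ?'p = 'p, of q]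
  by (simp add: of_rat_padic LIMSEQ_const_iff)

lemma padic_abs_eq_0_iff [simp]: "padic_abs x = 0 \<longleftrightarrow> x = 0"
proof (induction x)
  case (Padic X)
  show ?case using padic_abs_Padic[OF Padic]
    by (auto simp: Padic_eq_0_iff[OF Padic] rat_null_def dest: LIMSEQ_unique)
qed

lemma padic_abs_nonneg [simp]: "padic_abs x \<ge> 0"
proof (induction x)
  case (Padic X)
  show ?case
    by (rule LIMSEQ_le_const[OF padic_abs_Padic[OF Padic]]) (simp add: rat_abs_nonneg[OF prime_card])
qed

lemma padic_abs_add: "padic_abs (x + y) \<le> max (padic_abs x) (padic_abs y)"
proof (induction x; induction y)
  fix X Y assume X: "rat_cauchy CARD('a) X" and Y: "rat_cauchy CARD('a) Y"
  show "padic_abs (Padic X + Padic Y :: 'a padic) \<le> max (padic_abs (Padic X :: 'a padic)) (padic_abs (Padic Y :: 'a padic))"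
    unfolding plus_Padic[OF X Y]
    by (rule LIMSEQ_le[OF padic_abs_Padic[OF rat_cauchy_add[OF prime_card X Y]]
          tendsto_max[OF padic_abs_Padic[OF X] padic_abs_Padic[OF Y]]])
       (auto simp: rat_abs_add[OF prime_card])
qed

lemma padic_abs_minus [simp]: "padic_abs (- x) = padic_abs x"
proof (induction x)
  case (Padic X)
  show ?case using LIMSEQ_unique[OF padic_abs_Padic[OF rat_cauchy_minus[OF prime_card Padic]]]
      padic_abs_Padic[OF Padic] by (simp add: uminus_Padic[OF Padic] rat_abs_minus[OF prime_card])
qed

lemma padic_abs_mult: "padic_abs (x * y) = padic_abs x * padic_abs y"
proof (induction x; induction y)
  fix X Y assume X: "rat_cauchy CARD('a) X" and Y: "rat_cauchy CARD('a) Y"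
  show "padic_abs (Padic X * Padic Y :: 'a padic) = padic_abs (Padic X :: 'a padic) * padic_abs (Padic Y :: 'a padic)"
    unfolding times_Padic[OF X Y]
  proof (rule LIMSEQ_unique[OF padic_abs_Padic[OF rat_cauchy_mult[OF prime_card X Y]]])
    show "(\<lambda>n. rat_abs CARD('a) (X n * Y n))
        \<longlonglongrightarrow> padic_abs (Padic X :: 'a padic) * padic_abs (Padic Y :: 'a padic)"
      unfolding rat_abs_mult[OF prime_card]
      by (rule tendsto_mult[OF padic_abs_Padic[OF X] padic_abs_Padic[OF Y]])
  qed
qed

lemma padic_abs_powi:
  assumes "x \<noteq> 0"
  shows "\<exists>k. padic_abs (x :: 'p::prime_card padic) = real CARD('p) powi (- k)"
  using assms
proof (induction x)
  case (Padic X)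
  then obtain c N where c: "c > 0" "\<And>n. n \<ge> N \<Longrightarrow> rat_abs CARD('p) (X n) = c"
    using rat_cauchy_not_null[OF prime_card Padic(1)] Padic_eq_0_iff by blast
  then have "(\<lambda>n. rat_abs CARD('p) (X n)) \<longlonglongrightarrow> c"
    by (intro tendsto_eventually) (auto simp: eventually_sequentially)
  then have "padic_abs (Padic X :: 'p padic) = c"
    using padic_abs_Padic[OF Padic(1)] LIMSEQ_unique by blast
  moreover have "c = real CARD('p) powi (- rat_ord CARD('p) (X N))"
    using c(1) c(2)[of N] by (auto simp: rat_abs_def split: if_splits)
  ultimately show ?case by blast
qed

text \<open>The valuation is integer-valued; the convention that 0 has valuation infinity is made
  explicit where it is used.\<close>

definition padic_ord :: "'p::prime_card padic \<Rightarrow> int" where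
  "padic_ord x = (THE k. padic_abs x = real CARD('p) powi (- k))"

lemma padic_abs_ord:
  assumes "x \<noteq> 0"
  shows "padic_abs (x :: 'p::prime_card padic) = real CARD('p) powi (- padic_ord x)"
proof -
  have p1: "real CARD('p) > 1"
    using prime_gt_1_nat[OF prime_card, where ?'a1='p] by simp
  have "\<exists>!k. padic_abs x = real CARD('p) powi (- k)"
  proof (rule ex_ex1I[OF padic_abs_powi[OF assms]])
    fix k l assume "padic_abs x = real CARD('p) powi (- k)" "padic_abs x = real CARD('p) powi (- l)"
    then have "real CARD('p) powi (- k) = real CARD('p) powi (- l)" by simp
    then show "k = l"
      using power_int_strict_increasing[OF _ p1, of "-k" "-l"]
        power_int_strict_increasing[OF _ p1, of "-l" "-k"] by (cases k l rule: linorder_cases) auto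
  qed
  then show ?thesis unfolding padic_ord_def by (rule theI')
qed

instantiation padic :: (prime_card) metric_space
begin

definition dist_padic :: "'a padic \<Rightarrow> 'a padic \<Rightarrow> real" where
  "dist_padic x y = padic_abs (x - y)"

definition uniformity_padic :: "('a padic \<times> 'a padic) filter" where
  "uniformity_padic = (INF e\<in>{0 <..}. principal {(x, y). dist x y < e})"

definition open_padic :: "'a padic set \<Rightarrow> bool" where
  "open_padic U \<longleftrightarrow> (\<forall>x\<in>U. \<forall>\<^sub>F (x', y) in uniformity. x' = x \<longrightarrow> y \<in> U)"

instance
proof
  fix x y z :: "'a padic"
  show "dist x y = 0 \<longleftrightarrow> x = y" by (simp add: dist_padic_def)
  have "padic_abs (x - y) \<le> max (padic_abs (x - z)) (padic_abs (z - y))"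
    using padic_abs_add[of "x - z" "z - y"] by simp
  moreover have "padic_abs (z - y) = padic_abs (y - z)" using padic_abs_minus[of "y - z"] by simp
  ultimately show "dist x y \<le> dist x z + dist y z"
    using padic_abs_nonneg[of "x - z"] padic_abs_nonneg[of "y - z"] unfolding dist_padic_def by linarith
qed (simp_all add: uniformity_padic_def open_padic_def)

end


section \<open>Number fields inside the p-adic numbers\<close>

definition rat_scale :: "rat \<Rightarrow> 'p::prime_card padic \<Rightarrow> 'p padic" where
  "rat_scale q x = of_rat q * x"

interpretation padic_rat: vector_space rat_scale
  by unfold_locales (simp_all add: rat_scale_def of_rat_add of_rat_mult algebra_simps)

definition subfield_of_padic :: "'p::prime_card padic set \<Rightarrow> bool" where
  "subfield_of_padic K \<longleftrightarrow> 0 \<in> K \<and> 1 \<in> K \<and>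
     (\<forall>x\<in>K. \<forall>y\<in>K. x + y \<in> K \<and> x * y \<in> K) \<and> (\<forall>x\<in>K. - x \<in> K \<and> inverse x \<in> K)"

definition number_field_degree :: "'p::prime_card padic set \<Rightarrow> nat \<Rightarrow> bool" where
  "number_field_degree K d \<longleftrightarrow> subfield_of_padic K \<and>
     (\<exists>B. finite B \<and> padic_rat.span B = K) \<and> padic_rat.dim K = d"


section \<open>c-maps and the associated continued fractions\<close>

definition Zp :: "'p::prime_card padic set" where
  "Zp = {x. padic_abs x \<le> 1}"

definition pZp :: "'p::prime_card padic set" where
  "pZp = (\<lambda>x. of_nat CARD('p) * x) ` Zp"

definition Up :: "'p::prime_card padic set" where
  "Up = Zp - pZp"

text \<open>For a non-zero reference entry, this is max(ord a - ord b, 0) with ord 0 = infinity.\<close>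

definition ord_gap :: "'p::prime_card padic \<Rightarrow> 'p padic \<Rightarrow> nat" where
  "ord_gap a b = (if b = 0 then 0 else nat (max (padic_ord a - padic_ord b) 0))"

definition vecs :: "'p::prime_card padic set \<Rightarrow> ('p padic ^ 's) set" where
  "vecs K = {x. \<forall>i. x $ i \<in> K}"

text \<open>The vectors u and v collect the constants of all coordinates: index j holds those of the
  distinguished coordinate, the other indices the primed ones.\<close>

definition frac_map :: "'p::prime_card padic set \<Rightarrow> 'p padic ^ 's \<Rightarrow> 's \<Rightarrow> 'p padic ^ 's \<Rightarrow> 'p padic ^ 's
    \<Rightarrow> ('p padic ^ 's \<rightharpoonup> 'p padic ^ 's)" where
  "frac_map K \<alpha> j u v x =
     (if x \<in> vecs K \<and> x $ j \<noteq> 0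
      then Some (\<chi> i. if i = j
                       then u $ j * of_nat CARD('p) powi padic_ord (\<alpha> $ j) / x $ j - v $ j
                       else u $ i * of_nat CARD('p) ^ ord_gap (\<alpha> $ j) (\<alpha> $ i) * x $ i / x $ j - v $ i)
      else None)"

record ('p, 's) cmap_data =
  cm_phi :: "'p padic ^ 's \<Rightarrow> 's"
  cm_F :: "'p padic ^ 's \<Rightarrow> ('p padic ^ 's \<rightharpoonup> 'p padic ^ 's)"
  cm_A :: "'p padic ^ 's \<Rightarrow> 'p padic ^ 's ^ 's"
  cm_gamma :: "'p padic ^ 's \<Rightarrow> 'p padic ^ 's"

definition is_cmap :: "'p::prime_card padic set \<Rightarrow> ('p, 's::finite) cmap_data \<Rightarrow> bool" where
  "is_cmap K \<Phi> \<longleftrightarrow>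
     (\<forall>\<alpha> \<in> vecs K.
        let j = cm_phi \<Phi> \<alpha>; A = cm_A \<Phi> \<alpha> in
        invertible A \<and>
        (\<forall>i k. A $ i $ k \<in> Zp \<inter> \<rat> \<and> matrix_inv A $ i $ k \<in> Zp \<inter> \<rat>) \<and>
        (\<forall>i. cm_gamma \<Phi> \<alpha> $ i \<in> pZp \<inter> \<rat>) \<and>
        (if \<alpha> $ j \<noteq> 0
         then \<exists>u v. (\<forall>i. u $ i \<in> Up \<inter> \<rat>) \<and> v $ j \<in> Up \<inter> \<rat> \<and>
                (\<forall>i. i \<noteq> j \<longrightarrow> v $ i \<in> Zp \<inter> \<rat>) \<and>
                cm_F \<Phi> \<alpha> = frac_map K \<alpha> j u v \<and>
                (\<forall>i. the (cm_F \<Phi> \<alpha> \<alpha>) $ i \<in> pZp)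
         else cm_F \<Phi> \<alpha> = (\<lambda>x. if x \<in> vecs K then Some x else None))) \<and>
     cm_gamma \<Phi> 0 = 0"

definition cm_T :: "('p::prime_card, 's::finite) cmap_data \<Rightarrow> 'p padic ^ 's \<Rightarrow> ('p padic ^ 's \<rightharpoonup> 'p padic ^ 's)" where
  "cm_T \<Phi> \<alpha> x = map_option (\<lambda>y. cm_A \<Phi> \<alpha> *v y + cm_gamma \<Phi> \<alpha>) (cm_F \<Phi> \<alpha> x)"

text \<open>Meant for maps that are injective on their domain, such as the maps of a c-map.\<close>

definition partial_inv :: "('a \<rightharpoonup> 'b) \<Rightarrow> ('b \<rightharpoonup> 'a)" where
  "partial_inv f y = (if y \<in> ran f then Some (THE x. f x = Some y) else None)"

fun remainder :: "('p::prime_card, 's::finite) cmap_data \<Rightarrow> 'p padic ^ 's \<Rightarrow> nat \<Rightarrow> 'p padic ^ 's" where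
  "remainder \<Phi> \<alpha> 0 = \<alpha>"
| "remainder \<Phi> \<alpha> (Suc n) = the (cm_T \<Phi> (remainder \<Phi> \<alpha> n) (remainder \<Phi> \<alpha> n))"

fun inv_comp :: "('p::prime_card, 's::finite) cmap_data \<Rightarrow> 'p padic ^ 's \<Rightarrow> nat
    \<Rightarrow> ('p padic ^ 's \<rightharpoonup> 'p padic ^ 's)" where
  "inv_comp \<Phi> \<alpha> 0 = Some"
| "inv_comp \<Phi> \<alpha> (Suc n) = inv_comp \<Phi> \<alpha> n \<circ>\<^sub>m partial_inv (cm_T \<Phi> (remainder \<Phi> \<alpha> n))"

text \<open>The value is None exactly when the composition is not defined at the zero vector.\<close>

definition convergent_at :: "('p::prime_card, 's::finite) cmap_data \<Rightarrow> 'p padic ^ 's \<Rightarrow> nat \<Rightarrow> ('p padic ^ 's) option" where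
  "convergent_at \<Phi> \<alpha> n = inv_comp \<Phi> \<alpha> n 0"

end

theory Submission
  imports Defs
begin

text \<open>
  On vectors of norm at most \<open>1/p\<close>, the inverse of \<open>T\<^sub>\<alpha>\<close> is Lipschitz with
  constant \<open>\<bar>\<alpha>\<bar>\<^sub>p\<close> when \<open>\<alpha>\<^sub>j \<noteq> 0\<close>, and it is an isometry when \<open>\<alpha>\<^sub>j = 0\<close>. All remainders
  after the first one with \<open>\<alpha>\<^sub>j \<noteq> 0\<close> have norm at most \<open>1/p\<close>, so every later one of this
  kind contributes a factor \<open>1/p\<close> to the distance between the convergent (the image of \<open>0\<close>) and
  \<open>\<alpha>\<close> (the image of the remainder) under the composed inverses.
\<close>

section \<open>The p-adic absolute value\<close>

lemma card_prime_gt_1: "real CARD('p::prime_card) > 1"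
  using prime_gt_1_nat[OF prime_card, where ?'a1='p] by simp

lemma padic_abs_0 [simp]: "padic_abs 0 = 0"
  by simp

lemma padic_abs_1 [simp]: "padic_abs 1 = 1"
  using padic_abs_mult[of 1 1] by (metis mult_cancel_right1 padic_abs_eq_0_iff zero_neq_one)

lemma padic_abs_inverse: "padic_abs (inverse x) = inverse (padic_abs x)"
proof (cases "x = 0")
  case False
  then show ?thesis using padic_abs_mult[of x "inverse x"]
    by (metis inverse_unique padic_abs_1 right_inverse)
qed simp

lemma padic_abs_divide: "padic_abs (x / y) = padic_abs x / padic_abs y"
  by (simp add: divide_inverse padic_abs_mult padic_abs_inverse)

lemma padic_abs_power: "padic_abs (x ^ n) = padic_abs x ^ n"
  by (induction n) (simp_all add: padic_abs_mult)

lemma padic_abs_power_int: "padic_abs (x powi n) = padic_abs x powi n"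
  by (simp add: power_int_def padic_abs_power padic_abs_inverse)

lemma padic_abs_add_le: "padic_abs x \<le> r \<Longrightarrow> padic_abs y \<le> r \<Longrightarrow> padic_abs (x + y) \<le> r"
  using padic_abs_add[of x y] by linarith

lemma padic_abs_diff_le: "padic_abs x \<le> r \<Longrightarrow> padic_abs y \<le> r \<Longrightarrow> padic_abs (x - y) \<le> r"
  using padic_abs_add_le[of x r "- y"] by simp

lemma padic_abs_sum_le:
  "r \<ge> 0 \<Longrightarrow> (\<And>i. i \<in> I \<Longrightarrow> padic_abs (f i) \<le> r) \<Longrightarrow> padic_abs (sum f I) \<le> r"
  by (induction I rule: infinite_finite_induct) (auto intro: padic_abs_add_le)

text \<open>Write y as (x + y) + (-x): the ultrametric inequality bounds |y| by the larger of |x +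
  y| and |x|, and |x| < |y| rules out the second.\<close>

lemma padic_abs_add_eq:
  assumes "padic_abs x < padic_abs y"
  shows "padic_abs (x + y) = padic_abs y"
  using assms padic_abs_add[of x y] padic_abs_add[of "x + y" "- x"] by simp

lemma padic_abs_prime: "padic_abs (of_nat CARD('p) :: 'p::prime_card padic) = 1 / real CARD('p)"
proof -
  have p: "prime CARD('p)" by (rule prime_card)
  have "rat_ord CARD('p) (of_int (int CARD('p)) / of_int 1) = 1"
    using prime_gt_0_nat[OF p] pint[OF p] by (subst rat_ord_Fract[OF p]) auto
  then have "rat_abs CARD('p) (of_nat CARD('p)) = 1 / real CARD('p)"
    using prime_gt_0_nat[OF p] by (simp add: rat_abs_def power_int_minus divide_inverse)
  then show ?thesis
    using padic_abs_of_rat[where ?'p='p, of "of_nat CARD('p)"] by simp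
qed

text \<open>Division by p multiplies the absolute value by p. This turns the integrality conditions
  of a c-map into norm bounds.\<close>

lemma pZp_abs: "x \<in> pZp \<longleftrightarrow> padic_abs (x :: 'p::prime_card padic) \<le> 1 / real CARD('p)"
proof
  assume "x \<in> pZp"
  then obtain z :: "'p padic" where "padic_abs z \<le> 1" "x = of_nat CARD('p) * z"
    by (auto simp: pZp_def Zp_def)
  then show "padic_abs x \<le> 1 / real CARD('p)"
    using card_prime_gt_1[where 'p='p]
    by (simp add: padic_abs_mult padic_abs_prime divide_right_mono)
next
  assume x: "padic_abs x \<le> 1 / real CARD('p)"
  have "x = of_nat CARD('p) * (x / of_nat CARD('p))" by simp
  moreover have "padic_abs (x / of_nat CARD('p)) \<le> 1"
    using x card_prime_gt_1[where 'p='p]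
    by (simp add: padic_abs_divide padic_abs_prime field_simps)
  ultimately show "x \<in> pZp" unfolding pZp_def Zp_def by blast
qed

text \<open>Nonzero absolute values are integral powers of p, so none lies strictly between 1/p and
  1.\<close>

lemma Up_abs: "x \<in> Up \<Longrightarrow> padic_abs (x :: 'p::prime_card padic) = 1"
proof -
  assume "x \<in> Up"
  then have x: "padic_abs x \<le> 1" "\<not> padic_abs x \<le> 1 / real CARD('p)"
    by (auto simp: Up_def Zp_def simp flip: pZp_abs)
  then have "x \<noteq> 0" using card_prime_gt_1[where 'p='p] by auto
  then obtain k where k: "padic_abs x = real CARD('p) powi (- k)"
    using padic_abs_powi by blast
  have "\<not> - k > 0"
    using x(1) k power_int_strict_increasing[of 0 "- k" "real CARD('p)"] card_prime_gt_1[where 'p='p]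
    by fastforce
  moreover have "\<not> - k \<le> - 1"
    using x(2) k power_int_increasing[of "- k" "- 1" "real CARD('p)"] card_prime_gt_1[where 'p='p]
    by (auto simp: power_int_minus divide_inverse)
  ultimately have "k = 0" by simp
  then show ?thesis using k by simp
qed

lemma padic_abs_powi_ord:
  "x \<noteq> 0 \<Longrightarrow> padic_abs (of_nat CARD('p) powi padic_ord x :: 'p padic)
    = padic_abs (x :: 'p::prime_card padic)"
  unfolding padic_abs_power_int padic_abs_prime
  by (simp add: padic_abs_ord power_int_minus power_int_inverse flip: inverse_eq_divide)

text \<open>This is what the exponents k_i are made for: dividing by p^k raises |a| exactly to |b|
  when |b| is larger and changes nothing otherwise. The convention \<open>ord_gap a 0 = 0\<close>
  fits, as |0| never exceeds |a|.\<close>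

lemma padic_abs_div_ord_gap:
  assumes "a \<noteq> (0 :: 'p::prime_card padic)"
  shows "padic_abs a / padic_abs (of_nat CARD('p) ^ ord_gap a b :: 'p padic)
    = max (padic_abs a) (padic_abs b)"
proof -
  let ?p = "real CARD('p)"
  have p: "?p > 1" by (rule card_prime_gt_1)
  have abs: "padic_abs a / padic_abs (of_nat CARD('p) ^ ord_gap a b :: 'p padic)
      = padic_abs a * ?p ^ ord_gap a b"
    by (simp add: padic_abs_power padic_abs_prime power_divide)
  show ?thesis
  proof (cases "b = 0 \<or> padic_ord a \<le> padic_ord b")
    case True
    then have "ord_gap a b = 0" by (auto simp: ord_gap_def)
    moreover have "padic_abs b \<le> padic_abs a"
      using True assms p
      by (cases "b = 0") (auto simp: padic_abs_ord[of a] padic_abs_ord[of b] intro!: power_int_increasing)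
    ultimately show ?thesis by (simp add: abs)
  next
    case False
    then have "?p ^ ord_gap a b = ?p powi (padic_ord a - padic_ord b)"
      by (simp add: ord_gap_def power_int_def)
    then have "padic_abs a * ?p ^ ord_gap a b = ?p powi (- padic_ord a + (padic_ord a - padic_ord b))"
      using assms p by (subst power_int_add) (simp_all add: padic_abs_ord)
    then have "padic_abs a * ?p ^ ord_gap a b = padic_abs b"
      using False by (simp add: padic_abs_ord)
    moreover have "padic_abs a \<le> padic_abs b"
      using False assms p by (auto simp: padic_abs_ord intro!: power_int_increasing)
    ultimately show ?thesis by (simp add: abs)
  qed
qed

section \<open>Sup-norm bounds on vectors\<close>

text \<open>A predicate rather than a maximum, so that ultrametric estimates apply coordinate by
  coordinate.\<close>

definition vec_le :: "'p::prime_card padic ^ 's \<Rightarrow> real \<Rightarrow> bool" where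
  "vec_le x r \<longleftrightarrow> (\<forall>i. padic_abs (x $ i) \<le> r)"

lemma vec_le_nonneg: "vec_le x r \<Longrightarrow> r \<ge> 0"
  unfolding vec_le_def using padic_abs_nonneg order_trans by blast

lemma vec_le_add: "vec_le x r \<Longrightarrow> vec_le y r \<Longrightarrow> vec_le (x + y) r"
  by (simp add: vec_le_def padic_abs_add_le)

lemma vec_le_diff: "vec_le x r \<Longrightarrow> vec_le y r \<Longrightarrow> vec_le (x - y) r"
  by (simp add: vec_le_def padic_abs_diff_le)

lemma vec_le_mult:
  assumes "\<And>i k. A $ i $ k \<in> Zp" "vec_le x r"
  shows "vec_le (A *v x) r"
  unfolding vec_le_def matrix_vector_mult_def vec_lambda_beta
proof (intro allI padic_abs_sum_le)
  fix i k
  show "padic_abs (A $ i $ k * x $ k) \<le> r"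
    using assms mult_mono[of "padic_abs (A $ i $ k)" 1 "padic_abs (x $ k)" r]
    by (auto simp: Zp_def vec_le_def padic_abs_mult)
qed (rule vec_le_nonneg[OF assms(2)])

text \<open>The inverse is integral too, so \<open>vec_le_mult\<close> applied to it undoes A
  without loss. Hence each A of a c-map acts as an isometry.\<close>

lemma vec_le_mult_cancel:
  assumes "invertible A" "\<And>i k. matrix_inv A $ i $ k \<in> Zp" "vec_le (A *v x) r"
  shows "vec_le x r"
proof -
  have "matrix_inv A ** A = mat 1"
    using assms(1) unfolding invertible_def matrix_inv_def by (rule someI2_ex) blast
  then have "matrix_inv A *v (A *v x) = x" by (simp add: matrix_vector_mul_assoc)
  then show ?thesis using vec_le_mult[OF assms(2,3)] by simp
qed


section \<open>The maps of a c-map\<close>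

text \<open>Solve for x with w = z + v. Since |z_j| < 1 = |v_j|, the entry w_j is a unit, so x_j =
  u_j p^(ord \<alpha>_j) / w_j has norm |\<alpha>_j|. The other entries are w_i times x_j / g_i, and
  the choice of k_i makes |x_j / g_i| = max(|\<alpha>_j|, |\<alpha>_i|), which is at most C.\<close>

lemma frac_map_lipschitz:
  fixes \<alpha> :: "'p::prime_card padic ^ 's"
  assumes \<alpha>: "\<alpha> $ j \<noteq> 0" "vec_le \<alpha> C"
    and u: "\<And>i. u $ i \<in> Up" and v: "v $ j \<in> Up" "\<And>i. v $ i \<in> Zp"
    and F: "frac_map K \<alpha> j u v x = Some z" "frac_map K \<alpha> j u v x' = Some z'"
    and z: "vec_le z (1 / real CARD('p))" "vec_le z' (1 / real CARD('p))" "vec_le (z - z') r"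
  shows "vec_le x C" "vec_le (x - x') (C * r)"
proof -
  let ?P = "of_nat CARD('p) powi padic_ord (\<alpha> $ j) :: 'p padic"
  define w where "w = z + v"
  define w' where "w' = z' + v"
  have ww: "w $ i - w' $ i = (z - z') $ i" for i by (simp add: w_def w'_def)
  have q1: "1 / real CARD('p) < 1" using card_prime_gt_1[where 'p='p] by simp
  have w_le: "padic_abs (w $ i) \<le> 1" "padic_abs (w' $ i) \<le> 1" for i
    using z(1,2) q1 v(2)[of i] less_imp_le[OF q1]
    by (auto simp: w_def w'_def vec_le_def Zp_def intro!: padic_abs_add_le intro: order_trans)
  have "padic_abs (z $ j) < padic_abs (v $ j)" "padic_abs (z' $ j) < padic_abs (v $ j)"
    using z(1,2) order.strict_trans1[OF _ q1] by (auto simp: Up_abs[OF v(1)] vec_le_def)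
  then have w_j: "padic_abs (w $ j) = 1" "padic_abs (w' $ j) = 1"
    by (simp_all add: w_def w'_def padic_abs_add_eq Up_abs[OF v(1)])
  then have w0: "w $ j \<noteq> 0" "w' $ j \<noteq> 0" by auto
  have u1: "padic_abs (u $ i) = 1" for i using Up_abs[OF u] .
  then have u0: "u $ i \<noteq> 0" for i by (metis padic_abs_0 zero_neq_one)
  have P: "padic_abs ?P = padic_abs (\<alpha> $ j)" by (rule padic_abs_powi_ord[OF \<alpha>(1)])
  \<comment> \<open>For i other than j this is the coefficient of x_i / x_j in the map, a unit times
    p^(k_i).\<close>
  define g where "g i = u $ i * of_nat CARD('p) ^ ord_gap (\<alpha> $ j) (\<alpha> $ i)" for i
  have g0: "g i \<noteq> 0" for i using u0 by (simp add: g_def)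
  have x0: "x $ j \<noteq> 0" "x' $ j \<noteq> 0" using F by (auto simp: frac_map_def split: if_splits)
  have wx: "w $ j = u $ j * ?P / x $ j" "w' $ j = u $ j * ?P / x' $ j"
    using F by (auto simp: w_def w'_def frac_map_def split: if_splits)
  then have xj: "x $ j = u $ j * ?P / w $ j" "x' $ j = u $ j * ?P / w' $ j"
    using x0 w0 by (auto simp: field_simps)
  have wi: "w $ i = g i * x $ i / x $ j" "w' $ i = g i * x' $ i / x' $ j" if "i \<noteq> j" for i
    using F that by (auto simp: w_def w'_def g_def frac_map_def split: if_splits)
  then have xi: "x $ i = w $ i * (x $ j / g i)" "x' $ i = w' $ i * (x' $ j / g i)" if "i \<noteq> j" for i
    using x0 g0 that by (auto simp: field_simps)
  have absj: "padic_abs (x $ j) = padic_abs (\<alpha> $ j)" "padic_abs (x' $ j) = padic_abs (\<alpha> $ j)"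
    by (simp_all add: xj padic_abs_divide padic_abs_mult u1 P w_j)
  have absg: "padic_abs (\<alpha> $ j) / padic_abs (g i) \<le> C" for i
    using padic_abs_div_ord_gap[OF \<alpha>(1), of "\<alpha> $ i"] \<alpha>(2)
    by (simp add: g_def padic_abs_mult u1 vec_le_def)
  have C: "C \<ge> 0" by (rule vec_le_nonneg[OF \<alpha>(2)])
  have r: "r \<ge> 0" by (rule vec_le_nonneg[OF z(3)])
  show "vec_le x C"
    unfolding vec_le_def
  proof
    fix i
    show "padic_abs (x $ i) \<le> C"
    proof (cases "i = j")
      case True
      then show ?thesis using absj \<alpha>(2) by (simp add: vec_le_def)
    next
      case False
      then show ?thesis
        using mult_mono[OF w_le(1)[of i] absg[of i]] by (simp add: xi padic_abs_mult padic_abs_divide absj)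
    qed
  qed
  \<comment> \<open>Both denominators have norm 1, so subtracting the reciprocals costs only the
    factor |\<alpha>_j|.\<close>
  have "x $ j - x' $ j = u $ j * ?P * (w' $ j - w $ j) / (w $ j * w' $ j)"
    using w0 by (simp add: xj field_simps)
  then have "padic_abs (x $ j - x' $ j) = padic_abs (\<alpha> $ j) * padic_abs (w' $ j - w $ j)"
    by (simp add: padic_abs_mult padic_abs_divide u1 P w_j)
  also have "padic_abs (w' $ j - w $ j) = padic_abs ((z - z') $ j)"
    by (metis ww minus_diff_eq padic_abs_minus)
  finally have dj: "padic_abs (x $ j - x' $ j) \<le> padic_abs (\<alpha> $ j) * r"
    using z(3) by (simp add: vec_le_def mult_left_mono)
  show "vec_le (x - x') (C * r)"
    unfolding vec_le_def
  proof
    fix i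
    show "padic_abs ((x - x') $ i) \<le> C * r"
    proof (cases "i = j")
      case True
      have "padic_abs (\<alpha> $ j) * r \<le> C * r" using \<alpha>(2) r by (simp add: vec_le_def mult_right_mono)
      then show ?thesis using dj True by simp
    next
      case False
      \<comment> \<open>A difference of products: one term varies w_i with x_j / g_i of norm at most
        C, the other varies x_j with w'_i integral. Each is at most \<open>C * r\<close>, hence so
        is the sum.\<close>
      have "(x - x') $ i = (z - z') $ i * (x $ j / g i) + w' $ i * ((x $ j - x' $ j) / g i)"
        unfolding ww[symmetric] by (simp add: xi[OF False] diff_divide_distrib algebra_simps)
      moreover have "padic_abs ((z - z') $ i * (x $ j / g i)) \<le> C * r"
        using mult_mono[OF _ absg[of i], of "padic_abs ((z - z') $ i)" r] z(3) r
        by (simp add: padic_abs_mult padic_abs_divide absj vec_le_def mult.commute)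
      moreover have "padic_abs (w' $ i * ((x $ j - x' $ j) / g i)) \<le> C * r"
      proof -
        have "padic_abs (x $ j - x' $ j) / padic_abs (g i) \<le> (padic_abs (\<alpha> $ j) * r) / padic_abs (g i)"
          by (rule divide_right_mono[OF dj]) simp
        also have "\<dots> \<le> C * r" using mult_right_mono[OF absg[of i] r] by simp
        finally show ?thesis
          using mult_mono[OF w_le(2)[of i], of "padic_abs (x $ j - x' $ j) / padic_abs (g i)" "C * r"]
          by (simp add: padic_abs_mult padic_abs_divide)
      qed
      ultimately show ?thesis by (simp add: padic_abs_add_le)
    qed
  qed
qed

section \<open>The field K and the data of a c-map\<close>

text \<open>The constants of a c-map are rational; this puts them in K, so that remainders stay in
  K^s.\<close>

lemma subfield_Rats:
  assumes "subfield_of_padic K"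
  shows "\<rat> \<subseteq> K"
proof
  fix x :: "'a padic" assume "x \<in> \<rat>"
  then obtain q where "x = of_rat q" by (auto simp: Rats_def)
  moreover obtain a b where "b \<noteq> 0" "q = of_int a / of_int b" by (rule rat_as_frac)
  ultimately have x: "x = of_int a * inverse (of_int b)"
    by (simp add: of_rat_divide) (simp add: divide_inverse)
  have n: "of_nat n \<in> K" for n
    using assms by (induction n) (auto simp: subfield_of_padic_def)
  have "of_int k \<in> K" for k
    using assms n by (cases k rule: int_cases2) (auto simp: subfield_of_padic_def)
  then show "x \<in> K" using assms x by (auto simp: subfield_of_padic_def)
qed

context
  fixes K :: "'p::prime_card padic set" and \<Phi> :: "('p, 's::finite) cmap_data"
  assumes K: "subfield_of_padic K" and cmap: "is_cmap K \<Phi>"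
begin

lemma K_closed:
  "x \<in> K \<Longrightarrow> y \<in> K \<Longrightarrow> x + y \<in> K" "x \<in> K \<Longrightarrow> y \<in> K \<Longrightarrow> x * y \<in> K"
  "x \<in> K \<Longrightarrow> y \<in> K \<Longrightarrow> x - y \<in> K" "x \<in> K \<Longrightarrow> y \<in> K \<Longrightarrow> x / y \<in> K"
  using K unfolding subfield_of_padic_def
  by (simp_all add: divide_inverse) (metis add_uminus_conv_diff)

lemma K_sum: "(\<And>i. i \<in> I \<Longrightarrow> f i \<in> K) \<Longrightarrow> sum f I \<in> K"
  using K by (induction I rule: infinite_finite_induct) (auto simp: K_closed subfield_of_padic_def)

lemma cmap_A:
  assumes "\<alpha> \<in> vecs K"
  shows "invertible (cm_A \<Phi> \<alpha>)" "cm_A \<Phi> \<alpha> $ i $ k \<in> Zp \<inter> \<rat>"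
    "matrix_inv (cm_A \<Phi> \<alpha>) $ i $ k \<in> Zp \<inter> \<rat>"
  using cmap assms unfolding is_cmap_def Let_def by blast+

lemma cmap_gamma:
  assumes "\<alpha> \<in> vecs K"
  shows "cm_gamma \<Phi> \<alpha> $ i \<in> \<rat>" "vec_le (cm_gamma \<Phi> \<alpha>) (1 / real CARD('p))"
  using cmap assms unfolding is_cmap_def Let_def vec_le_def pZp_abs[symmetric] by blast+

lemma cmap_active:
  assumes "\<alpha> \<in> vecs K" "\<alpha> $ cm_phi \<Phi> \<alpha> \<noteq> 0"
  obtains u v where "\<And>i. u $ i \<in> Up \<inter> \<rat>" "v $ cm_phi \<Phi> \<alpha> \<in> Up" "\<And>i. v $ i \<in> Zp \<inter> \<rat>"
    "cm_F \<Phi> \<alpha> = frac_map K \<alpha> (cm_phi \<Phi> \<alpha>) u v"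
    "vec_le (the (cm_F \<Phi> \<alpha> \<alpha>)) (1 / real CARD('p))"
proof -
  obtain u v where "\<forall>i. u $ i \<in> Up \<inter> \<rat>" "v $ cm_phi \<Phi> \<alpha> \<in> Up \<inter> \<rat>"
      "\<forall>i. i \<noteq> cm_phi \<Phi> \<alpha> \<longrightarrow> v $ i \<in> Zp \<inter> \<rat>" "cm_F \<Phi> \<alpha> = frac_map K \<alpha> (cm_phi \<Phi> \<alpha>) u v"
      "\<forall>i. the (cm_F \<Phi> \<alpha> \<alpha>) $ i \<in> pZp"
    using cmap assms unfolding is_cmap_def Let_def by (auto 0 3 dest!: bspec)
  \<comment> \<open>The distinguished entry is a unit, hence also integral, which gives one
    condition for all coordinates.\<close>
  moreover from this have "v $ i \<in> Zp \<inter> \<rat>" for i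
    by (cases "i = cm_phi \<Phi> \<alpha>") (auto simp: Up_def)
  ultimately show ?thesis using that[of u v] by (auto simp: vec_le_def pZp_abs)
qed

lemma cmap_inactive:
  assumes "\<alpha> \<in> vecs K" "\<alpha> $ cm_phi \<Phi> \<alpha> = 0"
  shows "cm_F \<Phi> \<alpha> = (\<lambda>x. if x \<in> vecs K then Some x else None)"
  using cmap assms unfolding is_cmap_def Let_def by (auto dest!: bspec)

section \<open>Inverting T_\<alpha>: contraction, isometry and injectivity\<close>

lemma cm_T_SomeE:
  assumes "cm_T \<Phi> \<alpha> x = Some y"
  obtains z where "cm_F \<Phi> \<alpha> x = Some z" "y = cm_A \<Phi> \<alpha> *v z + cm_gamma \<Phi> \<alpha>"
  using assms by (auto simp: cm_T_def)

text \<open>The translation by \<open>cm_gamma\<close> preserves the bound 1/p and drops out of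
  differences; what remains is the isometry A.\<close>

lemma cm_A_cancel:
  assumes "\<alpha> \<in> vecs K" "y = cm_A \<Phi> \<alpha> *v z + cm_gamma \<Phi> \<alpha>"
  shows "vec_le y (1 / real CARD('p)) \<Longrightarrow> vec_le z (1 / real CARD('p))"
    and "y' = cm_A \<Phi> \<alpha> *v z' + cm_gamma \<Phi> \<alpha> \<Longrightarrow> vec_le (y - y') r \<Longrightarrow> vec_le (z - z') r"
proof -
  have *: "vec_le (cm_A \<Phi> \<alpha> *v x) s \<Longrightarrow> vec_le x s" for x s
    using vec_le_mult_cancel[of "cm_A \<Phi> \<alpha>"] cmap_A[OF assms(1)] by blast
  show "vec_le z (1 / real CARD('p))" if "vec_le y (1 / real CARD('p))"
    using vec_le_diff[OF that cmap_gamma(2)[OF assms(1)]] * by (simp add: assms(2))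
  show "vec_le (z - z') r" if "y' = cm_A \<Phi> \<alpha> *v z' + cm_gamma \<Phi> \<alpha>" "vec_le (y - y') r"
    using that * by (simp add: assms(2) matrix_vector_mult_diff_distrib)
qed

lemma cm_T_active_lipschitz:
  assumes "\<alpha> \<in> vecs K" "\<alpha> $ cm_phi \<Phi> \<alpha> \<noteq> 0" "vec_le \<alpha> C"
    and T: "cm_T \<Phi> \<alpha> x = Some y" "cm_T \<Phi> \<alpha> x' = Some y'"
    and y: "vec_le y (1 / real CARD('p))" "vec_le y' (1 / real CARD('p))" "vec_le (y - y') r"
  shows "vec_le x C" "vec_le (x - x') (C * r)"
proof -
  obtain z where z: "cm_F \<Phi> \<alpha> x = Some z" "y = cm_A \<Phi> \<alpha> *v z + cm_gamma \<Phi> \<alpha>"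
    using T(1) by (rule cm_T_SomeE)
  obtain z' where z': "cm_F \<Phi> \<alpha> x' = Some z'" "y' = cm_A \<Phi> \<alpha> *v z' + cm_gamma \<Phi> \<alpha>"
    using T(2) by (rule cm_T_SomeE)
  obtain u v where "\<And>i. u $ i \<in> Up \<inter> \<rat>" "v $ cm_phi \<Phi> \<alpha> \<in> Up" "\<And>i. v $ i \<in> Zp \<inter> \<rat>"
    and F: "cm_F \<Phi> \<alpha> = frac_map K \<alpha> (cm_phi \<Phi> \<alpha>) u v"
    using cmap_active[OF assms(1,2)] by metis
  then have uv: "\<And>i. u $ i \<in> Up" "v $ cm_phi \<Phi> \<alpha> \<in> Up" "\<And>i. v $ i \<in> Zp" by auto
  note cancel = cm_A_cancel[OF assms(1)]
  note lip = frac_map_lipschitz[OF assms(2,3) uv z(1)[unfolded F] z'(1)[unfolded F]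
      cancel(1)[OF z(2) y(1)] cancel(1)[OF z'(2) y(2)] cancel(2)[OF z(2) z'(2) y(3)]]
  show "vec_le x C" "vec_le (x - x') (C * r)" by (rule lip)+
qed

text \<open>Here F is the identity, so T_\<alpha> is an integral affine isometry. The estimate for
  differences needs no bound on y.\<close>

lemma cm_T_inactive:
  assumes "\<alpha> \<in> vecs K" "\<alpha> $ cm_phi \<Phi> \<alpha> = 0"
    and T: "cm_T \<Phi> \<alpha> x = Some y"
  shows "vec_le y (1 / real CARD('p)) \<Longrightarrow> vec_le x (1 / real CARD('p))"
    and "cm_T \<Phi> \<alpha> x' = Some y' \<Longrightarrow> vec_le (y - y') r \<Longrightarrow> vec_le (x - x') r"
proof -
  have *: "y = cm_A \<Phi> \<alpha> *v x + cm_gamma \<Phi> \<alpha>" if "cm_T \<Phi> \<alpha> x = Some y" for x y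
    using that cmap_inactive[OF assms(1,2)] by (auto simp: cm_T_def split: if_splits)
  show "vec_le y (1 / real CARD('p)) \<Longrightarrow> vec_le x (1 / real CARD('p))"
    by (rule cm_A_cancel(1)[OF assms(1) *[OF T]])
  show "cm_T \<Phi> \<alpha> x' = Some y' \<Longrightarrow> vec_le (y - y') r \<Longrightarrow> vec_le (x - x') r"
    using cm_A_cancel(2)[OF assms(1) *[OF T]] * by blast
qed

text \<open>The Lipschitz estimate with r = 0: equal images force preimages at distance 0. In the
  active case that estimate is available only for y of norm at most 1/p, which is where the inverse
  gets evaluated.\<close>

lemma cm_T_inj:
  assumes "\<alpha> \<in> vecs K" "cm_T \<Phi> \<alpha> x = Some y" "cm_T \<Phi> \<alpha> x' = Some y"
    "vec_le y (1 / real CARD('p)) \<or> \<alpha> $ cm_phi \<Phi> \<alpha> = 0"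
  shows "x = x'"
proof -
  have 0: "vec_le (y - y) 0" by (simp add: vec_le_def)
  have "vec_le (x - x') 0"
  proof (cases "\<alpha> $ cm_phi \<Phi> \<alpha> = 0")
    case True
    then show ?thesis using cm_T_inactive(2)[OF assms(1) _ assms(2,3) 0] by blast
  next
    case False
    \<comment> \<open>Any finite bound C will do, because it is multiplied by r = 0.\<close>
    have "vec_le \<alpha> (Max (range (\<lambda>i. padic_abs (\<alpha> $ i))))" by (simp add: vec_le_def)
    then show ?thesis
      using cm_T_active_lipschitz(2)[OF assms(1) False _ assms(2,3) _ _ 0] assms(4) False by force
  qed
  then have "padic_abs (x $ i - x' $ i) = 0" for i
    by (intro order.antisym padic_abs_nonneg) (simp add: vec_le_def)
  then show ?thesis by (simp add: vec_eq_iff)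
qed

text \<open>\<open>partial_inv\<close> picks its value with \<open>THE\<close>, which is informative
  only once the preimage of y is known to be unique.\<close>

lemma partial_inv_cm_T:
  assumes "\<alpha> \<in> vecs K" "vec_le y (1 / real CARD('p)) \<or> \<alpha> $ cm_phi \<Phi> \<alpha> = 0"
    and "partial_inv (cm_T \<Phi> \<alpha>) y = Some x"
  shows "cm_T \<Phi> \<alpha> x = Some y"
proof -
  obtain x' where x': "cm_T \<Phi> \<alpha> x' = Some y"
    using assms(3) by (auto simp: partial_inv_def ran_def split: if_splits)
  have "(THE x. cm_T \<Phi> \<alpha> x = Some y) = x'"
    using x' cm_T_inj[OF assms(1) _ x' assms(2)] by (rule the_equality)
  then show ?thesis using assms(3) x' by (auto simp: partial_inv_def split: if_splits)
qed

text \<open>An active step forces the bound 1/p, since F sends \<alpha> into pZ_p; an inactive step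
  can only pass on a bound that \<alpha> already has.\<close>

lemma cm_T_self:
  assumes "\<alpha> \<in> vecs K"
  obtains \<beta> where "cm_T \<Phi> \<alpha> \<alpha> = Some \<beta>" "\<beta> \<in> vecs K"
    "\<alpha> $ cm_phi \<Phi> \<alpha> \<noteq> 0 \<or> vec_le \<alpha> (1 / real CARD('p)) \<Longrightarrow> vec_le \<beta> (1 / real CARD('p))"
proof -
  note Rats = subsetD[OF subfield_Rats[OF K]]
  obtain z where z: "cm_F \<Phi> \<alpha> \<alpha> = Some z" "z \<in> vecs K"
    "\<alpha> $ cm_phi \<Phi> \<alpha> \<noteq> 0 \<or> vec_le \<alpha> (1 / real CARD('p)) \<Longrightarrow> vec_le z (1 / real CARD('p))"
  proof (cases "\<alpha> $ cm_phi \<Phi> \<alpha> = 0")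
    case True
    then show ?thesis using that[of \<alpha>] assms cmap_inactive[OF assms] by auto
  next
    case False
    obtain u v where uv: "\<And>i. u $ i \<in> Up \<inter> \<rat>" "\<And>i. v $ i \<in> Zp \<inter> \<rat>"
      and F: "cm_F \<Phi> \<alpha> = frac_map K \<alpha> (cm_phi \<Phi> \<alpha>) u v"
      and le: "vec_le (the (cm_F \<Phi> \<alpha> \<alpha>)) (1 / real CARD('p))"
      using cmap_active[OF assms False] by metis
    have "u $ i \<in> K" "v $ i \<in> K" for i using uv Rats by auto
    moreover have "of_nat CARD('p) ^ n \<in> K" "of_nat CARD('p) powi k \<in> K" for n k
      by (intro Rats; simp add: power_int_def Rats_power Rats_inverse)+
    moreover have "\<alpha> $ i \<in> K" for i using assms by (simp add: vecs_def)
    ultimately have "the (cm_F \<Phi> \<alpha> \<alpha>) \<in> vecs K"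
      using assms False by (auto simp: F frac_map_def vecs_def intro!: K_closed)
    moreover have "cm_F \<Phi> \<alpha> \<alpha> \<noteq> None" using assms False by (simp add: F frac_map_def)
    ultimately show ?thesis using that le by auto
  qed
  let ?\<beta> = "cm_A \<Phi> \<alpha> *v z + cm_gamma \<Phi> \<alpha>"
  have "?\<beta> \<in> vecs K"
    using z(2) cmap_A(2)[OF assms] cmap_gamma(1)[OF assms] Rats
    by (auto simp: vecs_def matrix_vector_mult_def intro!: K_closed K_sum)
  moreover have "vec_le ?\<beta> (1 / real CARD('p))"
    if "\<alpha> $ cm_phi \<Phi> \<alpha> \<noteq> 0 \<or> vec_le \<alpha> (1 / real CARD('p))"
    using z(3)[OF that] cmap_A(2)[OF assms] cmap_gamma(2)[OF assms]
    by (intro vec_le_add vec_le_mult) auto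
  ultimately show ?thesis using that[of ?\<beta>] z(1) by (simp add: cm_T_def)
qed


section \<open>Convergence\<close>

context
  fixes \<alpha> :: "'p padic ^ 's"
  assumes \<alpha>: "\<alpha> \<in> vecs K"
begin

abbreviation active :: "nat \<Rightarrow> bool" where
  "active n \<equiv> remainder \<Phi> \<alpha> n $ cm_phi \<Phi> (remainder \<Phi> \<alpha> n) \<noteq> 0"

lemma remainder_vecs: "remainder \<Phi> \<alpha> n \<in> vecs K"
proof (induction n)
  case (Suc n)
  then show ?case by (auto elim: cm_T_self)
qed (simp add: \<alpha>)

lemma cm_T_remainder:
  "cm_T \<Phi> (remainder \<Phi> \<alpha> n) (remainder \<Phi> \<alpha> n) = Some (remainder \<Phi> \<alpha> (Suc n))"
  by (rule cm_T_self[OF remainder_vecs[of n]]) simp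

text \<open>The bound 1/p appears right after the active index m and survives every later step of
  either kind.\<close>

lemma remainder_le:
  assumes "active m" "n > m"
  shows "vec_le (remainder \<Phi> \<alpha> n) (1 / real CARD('p))"
proof -
  have *: "vec_le (remainder \<Phi> \<alpha> (Suc n)) (1 / real CARD('p))"
    if "active n \<or> vec_le (remainder \<Phi> \<alpha> n) (1 / real CARD('p))" for n
    using that by (auto intro: cm_T_self[OF remainder_vecs[of n]])
  have "Suc m \<le> n" using assms(2) by simp
  then show ?thesis
    by (induction n rule: dec_induct) (use * assms(1) in blast)+
qed

text \<open>Before the first active index the remainders may be large, but the inactive maps
  preserve distances regardless of size.\<close>

lemma inv_comp_isometry:
  assumes "\<And>k. k < n \<Longrightarrow> \<not> active k" "inv_comp \<Phi> \<alpha> n y = Some x" "vec_le (y - remainder \<Phi> \<alpha> n) r"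
  shows "vec_le (x - \<alpha>) r"
  using assms
proof (induction n arbitrary: y)
  case (Suc n)
  \<comment> \<open>\<open>inv_comp\<close> applies the inverse with the highest index first, so the
    induction peels that one off and y must vary.\<close>
  obtain x' where x': "partial_inv (cm_T \<Phi> (remainder \<Phi> \<alpha> n)) y = Some x'" "inv_comp \<Phi> \<alpha> n x' = Some x"
    using Suc.prems(2) by (auto simp: map_comp_Some_iff)
  have n: "remainder \<Phi> \<alpha> n $ cm_phi \<Phi> (remainder \<Phi> \<alpha> n) = 0" using Suc.prems(1) by blast
  then have T: "cm_T \<Phi> (remainder \<Phi> \<alpha> n) x' = Some y"
    using partial_inv_cm_T[OF remainder_vecs _ x'(1)] by blast
  have "vec_le (x' - remainder \<Phi> \<alpha> n) r"
    by (rule cm_T_inactive(2)[OF remainder_vecs n T cm_T_remainder Suc.prems(3)])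
  then show ?case using Suc.IH[OF _ x'(2)] Suc.prems(1) less_SucI by blast
qed simp

text \<open>The first active index m contributes C, which may exceed 1; each later active index
  contributes 1/p, because its remainder has norm at most 1/p. The indices below m act
  isometrically.\<close>

lemma inv_comp_contraction:
  assumes m: "\<And>k. k < m \<Longrightarrow> \<not> active k" "active m" "vec_le (remainder \<Phi> \<alpha> m) C"
    and n: "n > m"
    and y: "inv_comp \<Phi> \<alpha> n y = Some x" "vec_le y (1 / real CARD('p))" "vec_le (y - remainder \<Phi> \<alpha> n) r"
  shows "vec_le (x - \<alpha>) (C * (1 / real CARD('p)) ^ card {k. active k \<and> m < k \<and> k < n} * r)"
proof -
  have "Suc m \<le> n" using n by simp
  then show ?thesis using y
  proof (induction n arbitrary: y r rule: dec_induct)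
    case base
    obtain x' where x': "partial_inv (cm_T \<Phi> (remainder \<Phi> \<alpha> m)) y = Some x'" "inv_comp \<Phi> \<alpha> m x' = Some x"
      using base(1) by (auto simp: map_comp_Some_iff)
    have T: "cm_T \<Phi> (remainder \<Phi> \<alpha> m) x' = Some y"
      using partial_inv_cm_T[OF remainder_vecs _ x'(1)] base by blast
    have "vec_le (x' - remainder \<Phi> \<alpha> m) (C * r)"
      using cm_T_active_lipschitz(2)[OF remainder_vecs m(2,3) T cm_T_remainder base(2) _ base(3)]
        remainder_le[OF m(2)] by blast
    then have "vec_le (x - \<alpha>) (C * r)" using inv_comp_isometry[OF m(1) x'(2)] by blast
    moreover have "{k. active k \<and> m < k \<and> k < Suc m} = {}" by auto
    ultimately show ?case by (simp only: card.empty power_0 mult_1_right)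
  next
    case (step n)
    obtain x' where x': "partial_inv (cm_T \<Phi> (remainder \<Phi> \<alpha> n)) y = Some x'" "inv_comp \<Phi> \<alpha> n x' = Some x"
      using step.prems(1) by (auto simp: map_comp_Some_iff)
    have T: "cm_T \<Phi> (remainder \<Phi> \<alpha> n) x' = Some y"
      using partial_inv_cm_T[OF remainder_vecs _ x'(1)] step.prems by blast
    have le: "vec_le (remainder \<Phi> \<alpha> n) (1 / real CARD('p))"
      "vec_le (remainder \<Phi> \<alpha> (Suc n)) (1 / real CARD('p))"
      using step.hyps by (intro remainder_le[OF m(2)]; simp)+
    show ?case
    proof (cases "active n")
      case True
      \<comment> \<open>With 1/p as the bound on the remainder, this yields both the factor 1/p and
        the bound 1/p on x' that the induction hypothesis requires.\<close>
      note lip = cm_T_active_lipschitz[OF remainder_vecs True le(1) T cm_T_remainder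
          step.prems(2) le(2) step.prems(3)]
      have "{k. active k \<and> m < k \<and> k < Suc n} = insert n {k. active k \<and> m < k \<and> k < n}"
        using True step.hyps by auto
      then have "card {k. active k \<and> m < k \<and> k < Suc n} = Suc (card {k. active k \<and> m < k \<and> k < n})"
        by (simp only:) (subst card_insert_disjoint; simp)
      then show ?thesis using step.IH[OF x'(2) lip] by (simp only: power_Suc mult_ac)
    next
      case False
      then have n: "remainder \<Phi> \<alpha> n $ cm_phi \<Phi> (remainder \<Phi> \<alpha> n) = 0" by blast
      have "{k. active k \<and> m < k \<and> k < Suc n} = {k. active k \<and> m < k \<and> k < n}"
        using False less_Suc_eq by blast
      then show ?thesis
        using step.IH[OF x'(2) cm_T_inactive(1)[OF remainder_vecs n T step.prems(2)]
            cm_T_inactive(2)[OF remainder_vecs n T cm_T_remainder step.prems(3)]] by (simp only:)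
    qed
  qed
qed

end

end

section \<open>Counting active indices and passing to the limit\<close>

text \<open>Any N elements of S lie below a common bound M, so the count is at least N from M
  on.\<close>

lemma filterlim_card_less:
  fixes S :: "nat set"
  assumes "infinite S"
  shows "filterlim (\<lambda>n. card {k \<in> S. k < n}) at_top sequentially"
  unfolding filterlim_at_top
proof
  fix N
  obtain T where T: "finite T" "card T = N" "T \<subseteq> S"
    using infinite_arbitrarily_large[OF assms] by blast
  obtain M where M: "\<forall>k\<in>T. k < M" using T(1) finite_nat_set_iff_bounded by blast
  have "N \<le> card {k \<in> S. k < n}" if "n \<ge> M" for n
  proof -
    have "T \<subseteq> {k \<in> S. k < n}" using T(3) M that by force
    then show ?thesis using T(2) card_mono[of "{k \<in> S. k < n}" T] by simp
  qed
  then show "\<forall>\<^sub>F n in sequentially. N \<le> card {k \<in> S. k < n}"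
    unfolding eventually_sequentially by blast
qed

theorem theorem1:
  fixes K :: "'p::prime_card padic set"
    and d :: nat
    and \<Phi> :: "('p, 's::finite) cmap_data"
    and \<alpha> :: "'p padic ^ 's"
  assumes "number_field_degree K d"
    and "CARD('s) = (if d \<ge> 2 then d - 1 else 1)"
    and "is_cmap K \<Phi>"
    and "\<alpha> \<in> vecs K"
    and "infinite {n. remainder \<Phi> \<alpha> n $ cm_phi \<Phi> (remainder \<Phi> \<alpha> n) \<noteq> 0}"
  shows "((\<lambda>n. the (convergent_at \<Phi> \<alpha> n)) \<longlongrightarrow> \<alpha>)
           (inf sequentially (principal {n. n > 0 \<and> convergent_at \<Phi> \<alpha> n \<noteq> None}))"
proof -
  let ?q = "1 / real CARD('p)"
  let ?F = "inf sequentially (principal {n. n > 0 \<and> convergent_at \<Phi> \<alpha> n \<noteq> None})"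
  have K: "subfield_of_padic K" using assms(1) by (simp add: number_field_degree_def)
  note hyps = K assms(3,4)
  define m where "m = (LEAST n. active \<Phi> \<alpha> n)"
  have "\<exists>n. active \<Phi> \<alpha> n" using assms(5) not_finite_existsD by blast
  then have m: "active \<Phi> \<alpha> m" "\<And>k. k < m \<Longrightarrow> \<not> active \<Phi> \<alpha> k"
    unfolding m_def by (rule LeastI_ex, use not_less_Least in blast)
  define C where "C = Max (range (\<lambda>i. padic_abs (remainder \<Phi> \<alpha> m $ i)))"
  have C: "vec_le (remainder \<Phi> \<alpha> m) C" by (simp add: vec_le_def C_def)
  define c where "c n = card {k. active \<Phi> \<alpha> k \<and> m < k \<and> k < n}" for n
  have bound: "vec_le (the (convergent_at \<Phi> \<alpha> n) - \<alpha>) (C * ?q ^ c n * ?q)"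
    if "n > m" "convergent_at \<Phi> \<alpha> n \<noteq> None" for n
  proof -
    have 0: "vec_le 0 ?q" by (simp add: vec_le_def)
    have "inv_comp \<Phi> \<alpha> n 0 = Some (the (convergent_at \<Phi> \<alpha> n))"
      using that(2) by (simp add: convergent_at_def)
    then show ?thesis
      \<comment> \<open>Zero and the n-th remainder both have norm at most 1/p, so the initial
        distance is at most r = 1/p.\<close>
      unfolding c_def using m C that(1) 0 vec_le_diff[OF 0 remainder_le[OF hyps m(1) that(1)]]
      by (intro inv_comp_contraction[OF hyps])
  qed
  \<comment> \<open>Only active indices beyond m give a factor 1/p; discarding finitely many leaves
    infinitely many.\<close>
  have "infinite ({n. active \<Phi> \<alpha> n} - {..m})" using assms(5) by (intro Diff_infinite_finite) auto
  from filterlim_card_less[OF this] have "filterlim c at_top sequentially"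
    by (simp add: c_def[abs_def] not_le conj_assoc)
  moreover have "(\<lambda>n. ?q ^ n) \<longlonglongrightarrow> 0"
    using card_prime_gt_1[where 'p='p] by (intro LIMSEQ_power_zero) simp
  ultimately have "(\<lambda>n. ?q ^ c n) \<longlonglongrightarrow> 0" by (rule filterlim_compose[rotated])
  then have "(\<lambda>n. C * ?q ^ c n * ?q) \<longlonglongrightarrow> 0"
    by (intro tendsto_mult_left_zero tendsto_mult_right_zero)
  \<comment> \<open>The bound tends to 0 along all n, hence also along the finer filter of those n
    whose convergent is defined.\<close>
  then have lim: "((\<lambda>n. C * ?q ^ c n * ?q) \<longlongrightarrow> 0) ?F"
    by (rule tendsto_mono[OF inf_le1])
  show ?thesis
  proof (rule vec_tendstoI)
    fix i
    have "\<forall>\<^sub>F n in ?F. dist (the (convergent_at \<Phi> \<alpha> n) $ i) (\<alpha> $ i) \<le> C * ?q ^ c n * ?q"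
      unfolding eventually_inf_principal using eventually_gt_at_top[of m]
      by eventually_elim (use bound in \<open>auto simp: vec_le_def dist_padic_def\<close>)
    then show "((\<lambda>n. the (convergent_at \<Phi> \<alpha> n) $ i) \<longlongrightarrow> \<alpha> $ i) ?F"
      unfolding tendsto_dist_iff[of _ "\<alpha> $ i"]
      by (intro tendsto_sandwich[OF _ _ tendsto_const lim]) auto
  qed
qed

end
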